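(* For every point $(x_0,y_0)\in\{(x,y)\in\mathbb R^2 : y\ge x^2+1\}$ there exists a probability distribution on $\mathbb R$ (with finite fourth moment and positive variance) whose skewness equals $x_0$ and whose kurtosis equals $y_0$.
   Context: For a real random variable $X$ with finite fourth moment, mean $\mu$ and variance $\sigma^2>0$, the skewness is $\tau=E((X-\mu)^3)/\sigma^3$ and the kurtosis is $\kappa=E((X-\mu)^4)/\sigma^4$ (not the excess kurtosis). The skewness and kurtosis of a distribution are those of a random variable with that distribution. *)

theory Defs
  imports "HOL-Probability.Probability"
begin

text \<open>
  Here M is the underlying probability space and X a random variable on it. The definitions are
  only meaningful when X has a finite fourth moment and positive variance: the Bochner integral
  of a non-integrable function is 0, and division by zero yields 0.
\<close>

definition std_deviation :: "'a measure \<Rightarrow> ('a \<Rightarrow> real) \<Rightarrow> real" where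
  "std_deviation M X = sqrt (prob_space.variance M X)"

definition skewness :: "'a measure \<Rightarrow> ('a \<Rightarrow> real) \<Rightarrow> real" where
  "skewness M X =
    prob_space.expectation M (\<lambda>\<omega>. (X \<omega> - prob_space.expectation M X) ^ 3) / std_deviation M X ^ 3"

text \<open>This is not the excess kurtosis; no 3 is subtracted.\<close>

definition kurtosis :: "'a measure \<Rightarrow> ('a \<Rightarrow> real) \<Rightarrow> real" where
  "kurtosis M X =
    prob_space.expectation M (\<lambda>\<omega>. (X \<omega> - prob_space.expectation M X) ^ 4) / std_deviation M X ^ 4"

text \<open>
  For a distribution on the reals we use the identity random variable. The following
  lemmas show that any other random variable with that distribution gives the same value.
\<close>

lemma skewness_distr:
  assumes "X \<in> borel_measurable M"
  shows "skewness (distr M borel X) (\<lambda>x. x) = skewness M X"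
  using assms by (simp add: skewness_def std_deviation_def integral_distr)

lemma kurtosis_distr:
  assumes "X \<in> borel_measurable M"
  shows "kurtosis (distr M borel X) (\<lambda>x. x) = kurtosis M X"
  using assms by (simp add: kurtosis_def std_deviation_def integral_distr)

end

theory Submission
  imports Defs
begin

text \<open>
  Put \<open>d = y0 - x0\<^sup>2 \<ge> 1\<close> and let \<open>c < 0 < a\<close> be the roots of \<open>z\<^sup>2 = x0 * z + d\<close>.
  Consider a law supported on \<open>{a, c, 0}\<close> with mean 0 and variance 1. On the support,
  \<open>z\<^bsup>n+2\<^esup> = x0 * z\<^bsup>n+1\<^esup> + d * z\<^sup>n\<close> for \<open>n \<ge> 1\<close>, so its moments satisfy
  \<open>m\<^sub>3 = x0 * m\<^sub>2 + d * m\<^sub>1 = x0\<close> and \<open>m\<^sub>4 = x0 * m\<^sub>3 + d * m\<^sub>2 = x0\<^sup>2 + d = y0\<close>.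
  Since the law is already standardised, these are its skewness and its kurtosis.

  The conditions on the mean and the variance force the weights \<open>1 / (a * (a - c))\<close> at \<open>a\<close> and
  \<open>1 / (c * (c - a))\<close> at \<open>c\<close>. Both are positive, and they add up to \<open>- 1 / (a * c) = 1 / d\<close>,
  which is at most 1 exactly because \<open>y0 \<ge> x0\<^sup>2 + 1\<close>; the rest of the mass goes to the
  point 0, where it affects no moment.
\<close>

text \<open>
  The bound \<open>1 \<le> - (a * c)\<close> leaves a nonnegative mass for the point 0. The weights at
  \<open>z = a, c\<close> are \<open>1 / z\<close> times the coefficients of the divided difference on the nodes
  \<open>a, c\<close>, and the factor \<open>1 / z\<close> lowers the exponent by one.
\<close>

lemma ex_three_point_pmf:
  fixes a c :: real
  assumes "c < 0" "0 < a" "1 \<le> - (a * c)"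
  obtains p :: "real pmf" where
    "finite (set_pmf p)"
    "\<And>n. measure_pmf.expectation p (\<lambda>x. x ^ Suc n) = (a ^ n - c ^ n) / (a - c)"
proof -
  define u where "u = 1 / (a * (a - c))"
  define v where "v = 1 / (c * (c - a))"
  define xs where "xs = [(a, u), (c, v), (0, 1 - u - v)]"
  have nz: "a \<noteq> 0" "c \<noteq> 0" "a - c \<noteq> 0" "c - a \<noteq> 0"
    using assms by auto
  have pos: "0 \<le> u" "0 \<le> v"
    using assms by (auto simp: u_def v_def intro!: mult_nonpos_nonpos)
  have "u + v = 1 / - (a * c)"
    using nz by (simp add: u_def v_def divide_simps) (simp add: algebra_simps)
  also have "\<dots> \<le> 1"
    using assms(3) by (subst divide_le_eq_1_pos) linarith+
  finally have "u + v \<le> 1" .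
  then have wf: "pmf_of_list_wf xs"
    using pos by (auto simp: pmf_of_list_wf_def xs_def)
  define p where "p = pmf_of_list xs"
  have supp: "set_pmf p \<subseteq> {a, c, 0}"
    using set_pmf_of_list[OF wf] by (auto simp: p_def xs_def)
  have pmf: "pmf p a = u" "pmf p c = v"
    using assms unfolding p_def pmf_pmf_of_list[OF wf] by (auto simp: xs_def)
  have "measure_pmf.expectation p (\<lambda>x. x ^ Suc n) = (a ^ n - c ^ n) / (a - c)" for n
  proof -
    have "measure_pmf.expectation p (\<lambda>x. x ^ Suc n) = (\<Sum>x\<in>{a, c, 0}. x ^ Suc n * pmf p x)"
      using supp by (intro integral_measure_pmf_real) auto
    also have "\<dots> = a ^ Suc n * u + c ^ Suc n * v"
      using assms pmf by simp
    also have "a ^ Suc n * u = a ^ n / (a - c)"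
      using nz by (simp add: u_def)
    also have "c ^ Suc n * v = - (c ^ n / (a - c))"
      using nz by (simp add: v_def divide_simps) (simp add: algebra_simps)
    finally show ?thesis
      by (simp add: diff_divide_distrib)
  qed
  moreover have "finite (set_pmf p)"
    using supp by (rule finite_subset) simp
  ultimately show thesis
    using that by blast
qed

theorem theorem5p1:
  fixes x0 y0 :: real
  assumes "(x0, y0) \<in> {(x, y). y \<ge> x\<^sup>2 + 1}"
  shows "\<exists>D :: real measure. real_distribution D \<and>
    integrable D (\<lambda>x. x ^ 4) \<and>
    prob_space.variance D (\<lambda>x. x) > 0 \<and>
    skewness D (\<lambda>x. x) = x0 \<and>
    kurtosis D (\<lambda>x. x) = y0"
proof -
  define d where "d = y0 - x0\<^sup>2"
  have d: "1 \<le> d"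
    using assms by (simp add: d_def)
  define s where "s = sqrt (x0\<^sup>2 + 4 * d)"
  define a where "a = (x0 + s) / 2"
  define c where "c = (x0 - s) / 2"
  have s_sq: "s\<^sup>2 = x0\<^sup>2 + 4 * d"
    using d by (simp add: s_def)
  have "\<bar>x0\<bar> < s"
    unfolding s_def using d by (intro real_less_rsqrt) simp
  then have "c < 0" "0 < a"
    by (auto simp: a_def c_def)
  have sum: "a + c = x0"
    by (simp add: a_def c_def field_simps)
  have prod: "- (a * c) = d"
    using s_sq by (simp add: a_def c_def power2_eq_square field_simps)
  obtain p :: "real pmf" where fin: "finite (set_pmf p)"
    and moment: "\<And>n. measure_pmf.expectation p (\<lambda>x. x ^ Suc n) = (a ^ n - c ^ n) / (a - c)"
    using ex_three_point_pmf[OF \<open>c < 0\<close> \<open>0 < a\<close>] prod d by metis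
  have nz: "a - c \<noteq> 0"
    using \<open>c < 0\<close> \<open>0 < a\<close> by simp
  have m1: "measure_pmf.expectation p (\<lambda>x. x) = 0"
    using moment[of 0] by simp
  have m2: "measure_pmf.expectation p (\<lambda>x. x\<^sup>2) = 1"
    using moment[of 1] nz by (simp add: numeral_2_eq_2)
  have "a\<^sup>2 - c\<^sup>2 = x0 * (a - c)"
    unfolding sum[symmetric] by (simp add: power2_eq_square algebra_simps)
  then have m3: "measure_pmf.expectation p (\<lambda>x. x ^ 3) = x0"
    using moment[of 2] nz by (simp add: eval_nat_numeral)
  have "a ^ 3 - c ^ 3 = ((a + c)\<^sup>2 - a * c) * (a - c)"
    by (simp add: power2_eq_square power3_eq_cube algebra_simps)
  also have "(a + c)\<^sup>2 - a * c = y0"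
    using sum prod by (simp add: d_def)
  finally have m4: "measure_pmf.expectation p (\<lambda>x. x ^ 4) = y0"
    using moment[of 3] nz by (simp add: eval_nat_numeral)

  \<comment> \<open>A pmf measures every set of reals, whereas a real distribution lives on the Borel sets.\<close>
  define D where "D = distr (measure_pmf p) borel (\<lambda>x. x)"
  have meas: "(\<lambda>x. x) \<in> borel_measurable (measure_pmf p)"
    by simp
  have "real_distribution D"
    unfolding D_def by (intro prob_space.real_distribution_distr prob_space_measure_pmf) simp
  moreover have "integrable D (\<lambda>x. x ^ 4)"
    unfolding D_def using fin
    by (subst integrable_distr_eq) (auto intro: integrable_measure_pmf_finite)
  moreover have "prob_space.variance D (\<lambda>x. x) > 0"
    unfolding D_def by (simp add: integral_distr m1 m2)
  moreover have "skewness D (\<lambda>x. x) = x0"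
    unfolding D_def skewness_distr[OF meas]
    by (simp add: skewness_def std_deviation_def m1 m2 m3)
  moreover have "kurtosis D (\<lambda>x. x) = y0"
    unfolding D_def kurtosis_distr[OF meas]
    by (simp add: kurtosis_def std_deviation_def m1 m2 m4)
  ultimately show ?thesis
    by blast
qed

end
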